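(* Let $\mathbf{G}$ be a Carnot group with first layer $V_1$, let $c:\mathbf{G}\times V_1\to\mathbb{R}$, let $\Omega\subset\mathbf{G}$, and let $u:\Omega\to\mathbb{R}$. (1) If $\partial_H^c u(g)\neq\emptyset$ for every $g\in\Omega$, then $u$ is $c$ H--convex. (2) Suppose that $c(g,\cdot):V_1\to\mathbb{R}$ is continuous for every $g\in\Omega$ and that the following holds: for every $g\in\Omega$ and every sequence $\{v_n\}_n\subset V_1$ with $\|v_n\|\to+\infty$, there exists $g'\in H_g\cap\Omega$ such that $\limsup_n\big(c(g',v_n)-c(g,v_n)\big)=+\infty$. If $u$ is $c$ H--convex, then $\partial_H^c u(g)\neq\emptyset$ for every $g\in\Omega$.
   Context: A Carnot group $\mathbf{G}$ of step $r$ is a connected, simply connected, nilpotent Lie group whose Lie algebra $\mathfrak{g}$ of left--invariant vector fields is stratified: $\mathfrak{g}=V_1\oplus\dots\oplus V_r$ with $V_j\ne\{0\}$, $[V_1,V_j]=V_{j+1}$ for $1\le j\le r-1$, $[V_1,V_r]=0$. A scalar product is fixed on $\mathfrak{g}$ making the layers mutually orthogonal; $\|\cdot\|$ is the induced norm on $V_1$. The map $\exp:\mathfrak{g}\to\mathbf{G}$ is a global diffeomorphism. The horizontal plane at $g\in\mathbf{G}$ is $H_g=\{gh:\ h\in\exp(V_1)\}$. A function $u:\Omega\to(-\infty,+\infty]$ is proper if $u\not\equiv+\infty$ (and it never takes the value $-\infty$). A proper function $u:\Omega\subset\mathbf{G}\to(-\infty,+\infty]$ is $c$ H--convex if for every $g\in\Omega$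 the set $\mathcal{P}_g=\{(v,\alpha)\in V_1\times\mathbb{R}:\ c(g',v)+\alpha\le u(g')\ \ \forall g'\in H_g\cap\Omega\}$ is nonempty and $u(g)=\sup_{(v,\alpha)\in\mathcal{P}_g}(c(g,v)+\alpha)$. The $c$ H--subdifferential of $u$ at $g\in\Omega$ is $\partial_H^cu(g)=\{p\in V_1:\ u(g')\ge u(g)+c(g',p)-c(g,p)\ \ \forall g'\in H_g\cap\Omega\}$. *)

theory Defs
  imports "HOL-Analysis.Analysis" "HOL-Algebra.Generated_Groups"
begin

section \<open>Smooth maps between open subsets of Euclidean spaces\<close>

text \<open>Meaningful for open \<open>S\<close> only, since the derivative is the one at an interior point.\<close>

primrec C_k_on :: "nat \<Rightarrow> ('a::euclidean_space \<Rightarrow> 'b::real_normed_vector) \<Rightarrow> 'a set \<Rightarrow> bool" where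
  "C_k_on 0 f S \<longleftrightarrow> continuous_on S f"
| "C_k_on (Suc k) f S \<longleftrightarrow>
     (\<forall>x\<in>S. f differentiable (at x)) \<and> (\<forall>v. C_k_on k (\<lambda>x. frechet_derivative f (at x) v) S)"

definition C_infinity_on :: "('a::euclidean_space \<Rightarrow> 'b::real_normed_vector) \<Rightarrow> 'a set \<Rightarrow> bool" where
  "C_infinity_on f S \<longleftrightarrow> (\<forall>k. C_k_on k f S)"

section \<open>Lie groups\<close>

type_synonym ('g, 'e) chart = "'g set \<times> ('g \<Rightarrow> 'e)"

definition smooth_atlas :: "('g::topological_space, 'e::euclidean_space) chart set \<Rightarrow> bool" where
  "smooth_atlas A \<longleftrightarrow>
     (\<Union>(U, \<phi>)\<in>A. U) = UNIV \<and>
     (\<forall>(U, \<phi>)\<in>A. open U \<and> open (\<phi> ` U) \<and> homeomorphism U (\<phi> ` U) \<phi> (inv_into U \<phi>)) \<and>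
     (\<forall>(U, \<phi>)\<in>A. \<forall>(W, \<psi>)\<in>A. C_infinity_on (\<lambda>x. \<psi> (inv_into U \<phi> x)) (\<phi> ` (U \<inter> W)))"

definition smooth_fun :: "('g, 'e::euclidean_space) chart set \<Rightarrow> ('g \<Rightarrow> real) \<Rightarrow> bool" where
  "smooth_fun A f \<longleftrightarrow> (\<forall>(U, \<phi>)\<in>A. C_infinity_on (\<lambda>x. f (inv_into U \<phi> x)) (\<phi> ` U))"

text \<open>A (finite-dimensional real) Lie group whose underlying manifold is the whole type \<open>'g\<close>; the
  Hausdorff and second countability axioms are carried by the sort of \<open>'g\<close>.\<close>

locale lie_group = group G
  for G :: "'g::{t2_space,second_countable_topology} monoid" (structure) +
  fixes A :: "('g, 'e::euclidean_space) chart set"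
  assumes carrier_UNIV: "carrier G = UNIV"
    and atlas: "smooth_atlas A"
    and mult_continuous: "continuous_on UNIV (\<lambda>(x, y). x \<otimes> y)"
    and inv_continuous: "continuous_on UNIV (\<lambda>x. inv\<^bsub>G\<^esub> x)"
    and mult_smooth: "\<And>U \<phi> V \<psi> W \<theta>. (U, \<phi>) \<in> A \<Longrightarrow> (V, \<psi>) \<in> A \<Longrightarrow> (W, \<theta>) \<in> A \<Longrightarrow>
      C_infinity_on (\<lambda>(x, y). \<theta> (inv_into U \<phi> x \<otimes> inv_into V \<psi> y))
        {(x, y). x \<in> \<phi> ` U \<and> y \<in> \<psi> ` V \<and> inv_into U \<phi> x \<otimes> inv_into V \<psi> y \<in> W}"
    and inv_smooth: "\<And>U \<phi> W \<theta>. (U, \<phi>) \<in> A \<Longrightarrow> (W, \<theta>) \<in> A \<Longrightarrow>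
      C_infinity_on (\<lambda>x. \<theta> (inv\<^bsub>G\<^esub> (inv_into U \<phi> x))) {x \<in> \<phi> ` U. inv\<^bsub>G\<^esub> (inv_into U \<phi> x) \<in> W}"

section \<open>The Lie algebra of left-invariant vector fields\<close>

text \<open>Smooth vector fields are taken to be the derivations of the algebra of smooth functions. As
  HOL functions are total, a derivation is made to send non-smooth functions to \<open>0\<close>, so that equal
  vector fields are equal operators.\<close>

definition vector_field :: "('g, 'e::euclidean_space) chart set \<Rightarrow> (('g \<Rightarrow> real) \<Rightarrow> 'g \<Rightarrow> real) \<Rightarrow> bool" where
  "vector_field A X \<longleftrightarrow>
     (\<forall>f. smooth_fun A f \<longrightarrow> smooth_fun A (X f)) \<and>
     (\<forall>f. \<not> smooth_fun A f \<longrightarrow> X f = (\<lambda>_. 0)) \<and>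
     (\<forall>a b f h. smooth_fun A f \<longrightarrow> smooth_fun A h \<longrightarrow>
        X (\<lambda>p. a * f p + b * h p) = (\<lambda>p. a * X f p + b * X h p)) \<and>
     (\<forall>f h. smooth_fun A f \<longrightarrow> smooth_fun A h \<longrightarrow>
        X (\<lambda>p. f p * h p) = (\<lambda>p. X f p * h p + f p * X h p))"

definition left_invariant_fields ::
  "'g monoid \<Rightarrow> ('g, 'e::euclidean_space) chart set \<Rightarrow> (('g \<Rightarrow> real) \<Rightarrow> 'g \<Rightarrow> real) set" where
  "left_invariant_fields G A = {X. vector_field A X \<and>
     (\<forall>a f. smooth_fun A f \<longrightarrow> X (\<lambda>p. f (a \<otimes>\<^bsub>G\<^esub> p)) = (\<lambda>p. X f (a \<otimes>\<^bsub>G\<^esub> p)))}"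

text \<open>The Lie algebra with its fixed scalar product is handled through a Euclidean space \<open>'v\<close> and
  a linear bijection \<open>vf\<close> of \<open>'v\<close> onto the left-invariant vector fields: choosing a scalar product
  on the Lie algebra amounts to choosing such a bijection. The bracket of \<open>'v\<close> is the commutator
  of vector fields.\<close>

definition lie_bracket :: "('v \<Rightarrow> ('g \<Rightarrow> real) \<Rightarrow> 'g \<Rightarrow> real) \<Rightarrow> 'v \<Rightarrow> 'v \<Rightarrow> 'v" where
  "lie_bracket vf X Y = the_inv vf (\<lambda>f p. vf X (vf Y f) p - vf Y (vf X f) p)"

definition integral_curve ::
  "('g::topological_space, 'e::euclidean_space) chart set \<Rightarrow> (('g \<Rightarrow> real) \<Rightarrow> 'g \<Rightarrow> real) \<Rightarrow> (real \<Rightarrow> 'g) \<Rightarrow> bool" where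
  "integral_curve A X \<gamma> \<longleftrightarrow> continuous_on UNIV \<gamma> \<and>
     (\<forall>f t. smooth_fun A f \<longrightarrow> ((\<lambda>s. f (\<gamma> s)) has_real_derivative X f (\<gamma> t)) (at t))"

text \<open>The image of \<open>S\<close> under the exponential map, which sends \<open>X\<close> to the value at time \<open>1\<close> of the
  (unique) integral curve of \<open>X\<close> starting at the identity.\<close>

definition exp_image ::
  "'g::topological_space monoid \<Rightarrow> ('g, 'e::euclidean_space) chart set \<Rightarrow> ('v \<Rightarrow> ('g \<Rightarrow> real) \<Rightarrow> 'g \<Rightarrow> real)
    \<Rightarrow> 'v set \<Rightarrow> 'g set" where
  "exp_image G A vf S = {\<gamma> 1 | X \<gamma>. X \<in> S \<and> integral_curve A (vf X) \<gamma> \<and> \<gamma> 0 = \<one>\<^bsub>G\<^esub>}"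

section \<open>Carnot groups\<close>

primrec lower_central_series :: "'g monoid \<Rightarrow> nat \<Rightarrow> 'g set" where
  "lower_central_series G 0 = carrier G"
| "lower_central_series G (Suc k) = generate G
     {x \<otimes>\<^bsub>G\<^esub> y \<otimes>\<^bsub>G\<^esub> inv\<^bsub>G\<^esub> x \<otimes>\<^bsub>G\<^esub> inv\<^bsub>G\<^esub> y | x y. x \<in> lower_central_series G k \<and> y \<in> carrier G}"

definition nilpotent_group :: "'g monoid \<Rightarrow> bool" where
  "nilpotent_group G \<longleftrightarrow> (\<exists>k. lower_central_series G k = {\<one>\<^bsub>G\<^esub>})"

text \<open>The layers are \<open>V 1, \<dots>, V r\<close>; other values of \<open>V\<close> are irrelevant.\<close>

locale carnot_group = lie_group G A
  for G :: "'g::{t2_space,second_countable_topology} monoid" (structure)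
    and A :: "('g, 'e::euclidean_space) chart set" +
  fixes vf :: "'v::euclidean_space \<Rightarrow> ('g \<Rightarrow> real) \<Rightarrow> 'g \<Rightarrow> real"
    and V :: "nat \<Rightarrow> 'v set"
    and r :: nat
  assumes connected: "connected (UNIV :: 'g set)"
    and simply_connected: "simply_connected (UNIV :: 'g set)"
    and nilpotent: "nilpotent_group G"
    and vf_bij: "bij_betw vf UNIV (left_invariant_fields G A)"
    and vf_linear: "\<And>a b X Y f p. vf (a *\<^sub>R X + b *\<^sub>R Y) f p = a * vf X f p + b * vf Y f p"
    and step_pos: "1 \<le> r"
    and layer_subspace: "\<And>j. j \<in> {1..r} \<Longrightarrow> subspace (V j)"
    and layer_nonzero: "\<And>j. j \<in> {1..r} \<Longrightarrow> V j \<noteq> {0}"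
    and direct_sum: "\<And>X. \<exists>!w. (\<forall>j\<in>{1..r}. w j \<in> V j) \<and> (\<forall>j. j \<notin> {1..r} \<longrightarrow> w j = 0) \<and>
      X = (\<Sum>j=1..r. w j)"
    and stratified: "\<And>j. 1 \<le> j \<Longrightarrow> j < r \<Longrightarrow>
      span {lie_bracket vf X Y | X Y. X \<in> V 1 \<and> Y \<in> V j} = V (Suc j)"
    and stratified_last: "\<And>X Y. X \<in> V 1 \<Longrightarrow> Y \<in> V r \<Longrightarrow> lie_bracket vf X Y = 0"
    and layers_orthogonal: "\<And>i j X Y. i \<in> {1..r} \<Longrightarrow> j \<in> {1..r} \<Longrightarrow> i \<noteq> j \<Longrightarrow>
      X \<in> V i \<Longrightarrow> Y \<in> V j \<Longrightarrow> X \<bullet> Y = 0"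

definition horizontal_plane ::
  "'g::topological_space monoid \<Rightarrow> ('g, 'e::euclidean_space) chart set \<Rightarrow> ('v \<Rightarrow> ('g \<Rightarrow> real) \<Rightarrow> 'g \<Rightarrow> real)
    \<Rightarrow> 'v set \<Rightarrow> 'g \<Rightarrow> 'g set" where
  "horizontal_plane G A vf V1 g = {g \<otimes>\<^bsub>G\<^esub> h | h. h \<in> exp_image G A vf V1}"

section \<open>Convexity and subdifferential with respect to a cost function\<close>

text \<open>Here \<open>H g\<close> is the horizontal plane at \<open>g\<close> and \<open>V1\<close> the first layer.
  Functions on \<open>\<Omega>\<close> are total functions of which only the values on \<open>\<Omega>\<close> are used; likewise only
  the values of \<open>c\<close> on \<open>V1\<close> in the second argument are used.\<close>

definition proper_on :: "'g set \<Rightarrow> ('g \<Rightarrow> ereal) \<Rightarrow> bool" where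
  "proper_on \<Omega> u \<longleftrightarrow> (\<forall>g\<in>\<Omega>. u g \<noteq> -\<infinity>) \<and> (\<exists>g\<in>\<Omega>. u g \<noteq> \<infinity>)"

definition c_H_support ::
  "('g \<Rightarrow> 'g set) \<Rightarrow> 'v set \<Rightarrow> ('g \<Rightarrow> 'v \<Rightarrow> real) \<Rightarrow> 'g set \<Rightarrow> ('g \<Rightarrow> ereal) \<Rightarrow> 'g \<Rightarrow> ('v \<times> real) set" where
  "c_H_support H V1 c \<Omega> u g =
     {(v, \<alpha>). v \<in> V1 \<and> (\<forall>g' \<in> H g \<inter> \<Omega>. ereal (c g' v + \<alpha>) \<le> u g')}"

definition c_H_convex ::
  "('g \<Rightarrow> 'g set) \<Rightarrow> 'v set \<Rightarrow> ('g \<Rightarrow> 'v \<Rightarrow> real) \<Rightarrow> 'g set \<Rightarrow> ('g \<Rightarrow> ereal) \<Rightarrow> bool" where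
  "c_H_convex H V1 c \<Omega> u \<longleftrightarrow> proper_on \<Omega> u \<and>
     (\<forall>g\<in>\<Omega>. c_H_support H V1 c \<Omega> u g \<noteq> {} \<and>
        u g = (SUP (v, \<alpha>) \<in> c_H_support H V1 c \<Omega> u g. ereal (c g v + \<alpha>)))"

definition c_H_subdifferential ::
  "('g \<Rightarrow> 'g set) \<Rightarrow> 'v set \<Rightarrow> ('g \<Rightarrow> 'v \<Rightarrow> real) \<Rightarrow> 'g set \<Rightarrow> ('g \<Rightarrow> ereal) \<Rightarrow> 'g \<Rightarrow> 'v set" where
  "c_H_subdifferential H V1 c \<Omega> u g =
     {p \<in> V1. \<forall>g' \<in> H g \<inter> \<Omega>. u g' \<ge> u g + ereal (c g' p - c g p)}"

end

theory Submission
  imports Defs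
begin

text \<open>
  The geometry enters through two facts: every point lies in its own horizontal plane, because the
  constant curve integrates the zero field, and the first layer is closed, being a subspace of a
  finite-dimensional space.

  A subgradient \<open>p\<close> at \<open>g\<close> amounts to a supporting pair \<open>(p, u g - c g p)\<close> that attains the value
  \<open>u g\<close> at \<open>g\<close>. If one exists, the supremum over all supporting pairs is at least \<open>u g\<close>; it is at
  most \<open>u g\<close> since \<open>g \<in> H g\<close>. This is part (1).

  Conversely, convexity says only that \<open>u g\<close> is a supremum, that is, that supporting pairs come
  within any \<open>\<epsilon> > 0\<close> of \<open>u g\<close>: the \<open>\<epsilon>\<close>-subdifferentials are nonempty. They shrink with \<open>\<epsilon>\<close>, and
  their intersection is the subdifferential. Continuity of the cost makes them closed. The growth
  condition makes them bounded, since along a sequence in one of them \<open>c g' - c g\<close> stays below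
  \<open>u g' - u g + \<epsilon>\<close> for each \<open>g'\<close>, which rules out norms tending to infinity. So they are nested,
  nonempty and compact, and have a common point.
\<close>

lemma (in carnot_group) mem_horizontal_plane_self: "g \<in> horizontal_plane G A vf (V 1) g"
proof -
  have zero: "vf 0 f p = 0" for f p
    using vf_linear[of 0 0 0 0 f p] by simp
  have "0 \<in> V 1"
    using layer_subspace[of 1] step_pos subspace_0 by auto
  moreover have "integral_curve A (vf 0) (\<lambda>_. \<one>)"
    by (auto simp: integral_curve_def zero)
  ultimately have "\<one> \<in> exp_image G A vf (V 1)"
    unfolding exp_image_def by (intro CollectI exI[of _ 0] exI[of _ "\<lambda>_. \<one>"]) auto
  moreover have "g = g \<otimes> \<one>"
    using carrier_UNIV by simp
  ultimately show ?thesis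
    unfolding horizontal_plane_def by blast
qed

lemma c_H_convex_if_subdifferentials_nonempty:
  fixes u :: "'g \<Rightarrow> real"
  assumes ne: "\<Omega> \<noteq> {}"
    and self: "\<And>g. g \<in> \<Omega> \<Longrightarrow> g \<in> H g"
    and sub: "\<And>g. g \<in> \<Omega> \<Longrightarrow> c_H_subdifferential H V1 c \<Omega> (\<lambda>x. ereal (u x)) g \<noteq> {}"
  shows "c_H_convex H V1 c \<Omega> (\<lambda>x. ereal (u x))"
  unfolding c_H_convex_def
proof (intro conjI ballI)
  show "proper_on \<Omega> (\<lambda>x. ereal (u x))"
    using ne by (auto simp: proper_on_def)
next
  fix g assume g: "g \<in> \<Omega>"
  let ?P = "c_H_support H V1 c \<Omega> (\<lambda>x. ereal (u x)) g"
  obtain p where p: "p \<in> c_H_subdifferential H V1 c \<Omega> (\<lambda>x. ereal (u x)) g"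
    using sub[OF g] by blast
  then have mem: "(p, u g - c g p) \<in> ?P"
    by (auto simp: c_H_support_def c_H_subdifferential_def algebra_simps)
  then show "?P \<noteq> {}"
    by blast
  show "ereal (u g) = (SUP (v, \<alpha>) \<in> ?P. ereal (c g v + \<alpha>))"
  proof (rule antisym)
    show "ereal (u g) \<le> (SUP (v, \<alpha>) \<in> ?P. ereal (c g v + \<alpha>))"
      by (rule SUP_upper2[OF mem]) simp
    show "(SUP (v, \<alpha>) \<in> ?P. ereal (c g v + \<alpha>)) \<le> ereal (u g)"
      using g self[OF g] by (auto simp: c_H_support_def intro!: SUP_least)
  qed
qed

definition c_H_eps_subdifferential ::
  "('g \<Rightarrow> 'g set) \<Rightarrow> 'v set \<Rightarrow> ('g \<Rightarrow> 'v \<Rightarrow> real) \<Rightarrow> 'g set \<Rightarrow> ('g \<Rightarrow> real) \<Rightarrow> 'g \<Rightarrow> real \<Rightarrow> 'v set" where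
  "c_H_eps_subdifferential H V1 c \<Omega> u g \<epsilon> =
     {p \<in> V1. \<forall>g' \<in> H g \<inter> \<Omega>. c g' p - c g p \<le> u g' - u g + \<epsilon>}"

lemma c_H_eps_subdifferential_mono:
  "\<epsilon> \<le> \<delta> \<Longrightarrow> c_H_eps_subdifferential H V1 c \<Omega> u g \<epsilon> \<subseteq> c_H_eps_subdifferential H V1 c \<Omega> u g \<delta>"
  unfolding c_H_eps_subdifferential_def by (auto intro: order_trans[OF _ add_left_mono])

lemma c_H_subdifferential_eq_Inter_eps:
  fixes u :: "'g \<Rightarrow> real"
  shows "c_H_subdifferential H V1 c \<Omega> (\<lambda>x. ereal (u x)) g =
    (\<Inter>n. c_H_eps_subdifferential H V1 c \<Omega> u g (inverse (Suc n)))"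
proof -
  have "u g + (c g' p - c g p) \<le> u g'"
    if "\<And>n. c g' p - c g p \<le> u g' - u g + inverse (Suc n)" for g' p
  proof (rule field_le_epsilon)
    fix e :: real assume "e > 0"
    then obtain n where "inverse (Suc n) < e"
      using reals_Archimedean by blast
    then show "u g + (c g' p - c g p) \<le> u g' + e"
      using that[of n] by simp
  qed
  moreover have "c g' p - c g p \<le> u g' - u g + inverse (Suc n)"
    if "u g + (c g' p - c g p) \<le> u g'" for g' p and n :: nat
  proof -
    have "0 < inverse (real (Suc n))"
      by simp
    then show ?thesis
      using that by linarith
  qed
  ultimately show ?thesis
    by (fastforce simp: c_H_subdifferential_def c_H_eps_subdifferential_def)
qed

text \<open>A supporting pair \<open>(v, \<alpha>)\<close> with \<open>c g v + \<alpha> > u g - \<epsilon>\<close> exists because \<open>u g\<close> is finite and the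
  supremum of such values; eliminating \<open>\<alpha>\<close> makes \<open>v\<close> an \<open>\<epsilon>\<close>-subgradient.\<close>

lemma c_H_eps_subdifferential_nonempty:
  fixes u :: "'g \<Rightarrow> real"
  assumes "c_H_convex H V1 c \<Omega> (\<lambda>x. ereal (u x))" "g \<in> \<Omega>" "\<epsilon> > 0"
  shows "c_H_eps_subdifferential H V1 c \<Omega> u g \<epsilon> \<noteq> {}"
proof -
  let ?P = "c_H_support H V1 c \<Omega> (\<lambda>x. ereal (u x)) g"
  have "ereal (u g - \<epsilon>) < ereal (u g)"
    using assms(3) by simp
  also have "ereal (u g) = (SUP (v, \<alpha>) \<in> ?P. ereal (c g v + \<alpha>))"
    using assms(1,2) unfolding c_H_convex_def by blast
  finally obtain v \<alpha> where P: "(v, \<alpha>) \<in> ?P" and near: "u g - \<epsilon> < c g v + \<alpha>"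
    unfolding less_SUP_iff by auto
  have "c g' v - c g v \<le> u g' - u g + \<epsilon>" if "g' \<in> H g \<inter> \<Omega>" for g'
  proof -
    have "c g' v + \<alpha> \<le> u g'"
      using P that by (auto simp: c_H_support_def)
    then show ?thesis
      using near by simp
  qed
  moreover have "v \<in> V1"
    using P by (simp add: c_H_support_def)
  ultimately show ?thesis
    by (auto simp: c_H_eps_subdifferential_def)
qed

lemma closed_c_H_eps_subdifferential:
  fixes V1 :: "'v::topological_space set"
  assumes "closed V1" and cont: "\<And>g. g \<in> \<Omega> \<Longrightarrow> continuous_on V1 (c g)" and "g \<in> \<Omega>"
  shows "closed (c_H_eps_subdifferential H V1 c \<Omega> u g \<epsilon>)"
proof -
  have "closed {p \<in> V1. c g' p - c g p \<le> u g' - u g + \<epsilon>}" if "g' \<in> \<Omega>" for g'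
    using assms that by (intro continuous_on_closed_Collect_le continuous_intros) auto
  \<comment> \<open>The factor \<open>V1\<close> keeps the intersection right when no \<open>g'\<close> is left to range over.\<close>
  moreover have "c_H_eps_subdifferential H V1 c \<Omega> u g \<epsilon> =
      V1 \<inter> (\<Inter>g'\<in>H g \<inter> \<Omega>. {p \<in> V1. c g' p - c g p \<le> u g' - u g + \<epsilon>})"
    by (auto simp: c_H_eps_subdifferential_def)
  ultimately show ?thesis
    using assms(1) by auto
qed

text \<open>An unbounded \<open>\<epsilon>\<close>-subdifferential contains a sequence with norms tending to infinity. The
  point \<open>g'\<close> that the growth condition gives may depend on it, but the bound
  \<open>u g' - u g + \<epsilon>\<close> is a real number constant along the sequence, so the upper limit is not \<open>\<infinity>\<close>.\<close>

lemma bounded_c_H_eps_subdifferential: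
  fixes V1 :: "'v::real_normed_vector set"
  assumes growth: "\<And>v :: nat \<Rightarrow> 'v. (\<And>n. v n \<in> V1) \<Longrightarrow> filterlim (\<lambda>n. norm (v n)) at_top sequentially \<Longrightarrow>
      \<exists>g' \<in> H g \<inter> \<Omega>. limsup (\<lambda>n. ereal (c g' (v n) - c g (v n))) = \<infinity>"
  shows "bounded (c_H_eps_subdifferential H V1 c \<Omega> u g \<epsilon>)"
proof (rule ccontr)
  let ?K = "c_H_eps_subdifferential H V1 c \<Omega> u g \<epsilon>"
  assume "\<not> bounded ?K"
  then have "\<forall>n. \<exists>v\<in>?K. real n < norm v"
    unfolding bounded_iff by (metis not_le)
  then obtain v where K: "\<And>n. v n \<in> ?K" and big: "\<And>n. real n < norm (v n)"
    by metis
  have "filterlim (\<lambda>n. norm (v n)) at_top sequentially"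
    by (rule filterlim_at_top_mono[OF filterlim_real_sequentially])
      (auto intro!: always_eventually less_imp_le big)
  moreover have "v n \<in> V1" for n
    using K by (simp add: c_H_eps_subdifferential_def)
  ultimately obtain g' where g': "g' \<in> H g \<inter> \<Omega>"
    and lim: "limsup (\<lambda>n. ereal (c g' (v n) - c g (v n))) = \<infinity>"
    using growth by blast
  have "limsup (\<lambda>n. ereal (c g' (v n) - c g (v n))) \<le> ereal (u g' - u g + \<epsilon>)"
    using K g' by (intro Limsup_bounded always_eventually) (auto simp: c_H_eps_subdifferential_def)
  with lim show False
    by simp
qed

lemma c_H_subdifferential_nonempty_if_convex:
  fixes V1 :: "'v::euclidean_space set" and u :: "'g \<Rightarrow> real"
  assumes "closed V1" "g \<in> \<Omega>"
    and "\<And>g. g \<in> \<Omega> \<Longrightarrow> continuous_on V1 (c g)"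
    and growth: "\<And>v :: nat \<Rightarrow> 'v. (\<And>n. v n \<in> V1) \<Longrightarrow> filterlim (\<lambda>n. norm (v n)) at_top sequentially \<Longrightarrow>
      \<exists>g' \<in> H g \<inter> \<Omega>. limsup (\<lambda>n. ereal (c g' (v n) - c g (v n))) = \<infinity>"
    and convex: "c_H_convex H V1 c \<Omega> (\<lambda>x. ereal (u x))"
  shows "c_H_subdifferential H V1 c \<Omega> (\<lambda>x. ereal (u x)) g \<noteq> {}"
  unfolding c_H_subdifferential_eq_Inter_eps
proof (rule compact_nest)
  fix n :: nat
  show "compact (c_H_eps_subdifferential H V1 c \<Omega> u g (inverse (Suc n)))"
    unfolding compact_eq_bounded_closed
  proof
    show "bounded (c_H_eps_subdifferential H V1 c \<Omega> u g (inverse (Suc n)))"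
      by (rule bounded_c_H_eps_subdifferential) (rule growth)
    show "closed (c_H_eps_subdifferential H V1 c \<Omega> u g (inverse (Suc n)))"
      by (rule closed_c_H_eps_subdifferential) (use assms(1-3) in auto)
  qed
  show "c_H_eps_subdifferential H V1 c \<Omega> u g (inverse (Suc n)) \<noteq> {}"
    using convex assms(2) by (rule c_H_eps_subdifferential_nonempty) simp
next
  fix m n :: nat assume "m \<le> n"
  then have "inverse (real (Suc n)) \<le> inverse (real (Suc m))"
    by (simp add: field_simps)
  then show "c_H_eps_subdifferential H V1 c \<Omega> u g (inverse (Suc n))
      \<subseteq> c_H_eps_subdifferential H V1 c \<Omega> u g (inverse (Suc m))"
    by (rule c_H_eps_subdifferential_mono)
qed

theorem theorem4p1:
  fixes G :: "'g::{t2_space,second_countable_topology} monoid"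
    and A :: "('g, 'e::euclidean_space) chart set"
    and vf :: "'v::euclidean_space \<Rightarrow> ('g \<Rightarrow> real) \<Rightarrow> 'g \<Rightarrow> real"
    and V :: "nat \<Rightarrow> 'v set" and r :: nat
    and c :: "'g \<Rightarrow> 'v \<Rightarrow> real" and \<Omega> :: "'g set" and u :: "'g \<Rightarrow> real"
  assumes "carnot_group G A vf V r"
    and "\<Omega> \<noteq> {}"
  shows
    "((\<forall>g\<in>\<Omega>. c_H_subdifferential (horizontal_plane G A vf (V 1)) (V 1) c \<Omega> (\<lambda>x. ereal (u x)) g \<noteq> {}) \<longrightarrow>
        c_H_convex (horizontal_plane G A vf (V 1)) (V 1) c \<Omega> (\<lambda>x. ereal (u x)))
     \<and>
     ((\<forall>g\<in>\<Omega>. continuous_on (V 1) (c g)) \<longrightarrow>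
      (\<forall>g\<in>\<Omega>. \<forall>v :: nat \<Rightarrow> 'v. (\<forall>n. v n \<in> V 1) \<and> filterlim (\<lambda>n. norm (v n)) at_top sequentially \<longrightarrow>
         (\<exists>g' \<in> horizontal_plane G A vf (V 1) g \<inter> \<Omega>.
            limsup (\<lambda>n. ereal (c g' (v n) - c g (v n))) = \<infinity>)) \<longrightarrow>
      c_H_convex (horizontal_plane G A vf (V 1)) (V 1) c \<Omega> (\<lambda>x. ereal (u x)) \<longrightarrow>
      (\<forall>g\<in>\<Omega>. c_H_subdifferential (horizontal_plane G A vf (V 1)) (V 1) c \<Omega> (\<lambda>x. ereal (u x)) g \<noteq> {}))"
proof -
  interpret carnot_group G A vf V r
    by (rule assms(1))
  have "closed (V 1)"
    using layer_subspace[of 1] step_pos by (simp add: closed_subspace)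
  show ?thesis
  proof (intro conjI impI ballI, goal_cases)
    case 1
    then show ?case
      using assms(2) mem_horizontal_plane_self
      by (intro c_H_convex_if_subdifferentials_nonempty) auto
  next
    case (2 g)
    then show ?case
      using \<open>closed (V 1)\<close> by (intro c_H_subdifferential_nonempty_if_convex) auto
  qed
qed

end
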